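(* Let $\{B_n\}$ and $\{C_n\}$ be two matrix sequences such that $B_n$ is Hermitian for all large enough $n$, and put $A_n=B_n+C_n$. Let $[c,d]\subset\mathbb R$ be a closed interval. Assume that $\{B_n\}$ is strongly clustered at $[c,d]$, that $\|C_n\|_1=O(1)$ as $n\to\infty$, and that $\|A_n\|$ is uniformly bounded by a positive constant $C$ independent of $n$. Then $\{A_n\}$ is strongly clustered at $[c,d]$.
   Context: A matrix sequence $\{A_n\}$ is a sequence of complex matrices with $A_n$ of size $n\times n$; $\lambda_1(A_n),\dots,\lambda_n(A_n)$ are its eigenvalues counted with multiplicity. $\|\cdot\|$ is the operator (spectral) norm and $\|\cdot\|_1$ is the trace-norm (sum of the singular values). Strong clustering: for a nonempty closed $S\subset\mathbb C$ and $\varepsilon>0$ let $D(S,\varepsilon)=\bigcup_{s\in S}\{z\in\mathbb C:|z-s|<\varepsilon\}$. $\{A_n\}$ is strongly clustered at $S$ if for every $\varepsilon>0$ the number of indices $j$ with $\lambda_j(A_n)\notin D(S,\varepsilon)$ is $O(1)$ as $n\to\infty$ (bounded by a constant that may depend on $\varepsilon$ but not on $n$). *)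

theory Defs
  imports
    "HOL-Library.Landau_Symbols"
    "HOL-Analysis.L2_Norm"
    "Jordan_Normal_Form.Schur_Decomposition"
begin

text \<open>Index \<open>0\<close> is harmless: there is exactly one \<open>0 \<times> 0\<close> matrix, and it has no eigenvalues.\<close>

definition matrix_sequence :: "(nat \<Rightarrow> complex mat) \<Rightarrow> bool" where
  "matrix_sequence A \<longleftrightarrow> (\<forall>n. A n \<in> carrier_mat n n)"

definition hermitian :: "complex mat \<Rightarrow> bool" where
  "hermitian A \<longleftrightarrow> mat_adjoint A = A"

text \<open>The multiset \<open>\<lambda>\<^sub>1(A), \<dots>, \<lambda>\<^sub>n(A)\<close>, with algebraic multiplicities.\<close>

definition eigenvalues :: "complex mat \<Rightarrow> complex multiset" where
  "eigenvalues A = proots (char_poly A)"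

definition vec_norm :: "complex vec \<Rightarrow> real" where
  "vec_norm v = L2_set (\<lambda>i. cmod (v $ i)) {..<dim_vec v}"

text \<open>The supremum is over the closed unit ball rather than the unit sphere, so that the set is
  nonempty for \<open>0 \<times> 0\<close> matrices as well.\<close>

definition op_norm :: "complex mat \<Rightarrow> real" where
  "op_norm A = (SUP v \<in> {v \<in> carrier_vec (dim_col A). vec_norm v \<le> 1}. vec_norm (A *\<^sub>v v))"

text \<open>The eigenvalues of \<open>A\<^sup>* A\<close> are real and nonnegative, so that \<open>Re\<close> only changes the type.\<close>

definition singular_values :: "complex mat \<Rightarrow> real multiset" where
  "singular_values A = image_mset (\<lambda>z. sqrt (Re z)) (eigenvalues (mat_adjoint A * A))"

definition trace_norm :: "complex mat \<Rightarrow> real" where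
  "trace_norm A = sum_mset (singular_values A)"

definition nbhd :: "complex set \<Rightarrow> real \<Rightarrow> complex set" where
  "nbhd S \<epsilon> = (\<Union>s\<in>S. {z. cmod (z - s) < \<epsilon>})"

text \<open>Only meaningful for nonempty closed \<open>S\<close>.\<close>

definition strongly_clustered :: "(nat \<Rightarrow> complex mat) \<Rightarrow> complex set \<Rightarrow> bool" where
  "strongly_clustered A S \<longleftrightarrow>
     (\<forall>\<epsilon>>0. (\<lambda>n. real (size {# z \<in># eigenvalues (A n). z \<notin> nbhd S \<epsilon> #})) \<in> O(\<lambda>_. 1))"

lemma size_eigenvalues:
  assumes "A \<in> carrier_mat n n"
  shows "size (eigenvalues A) = n"
  using degree_monic_char_poly[OF assms] by (simp add: eigenvalues_def size_proots_complex)

lemma bdd_above_op_norm: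
  "bdd_above ((\<lambda>v. vec_norm (A *\<^sub>v v)) ` {v \<in> carrier_vec (dim_col A). vec_norm v \<le> 1})"
proof (rule bdd_aboveI2)
  fix v assume "v \<in> {v \<in> carrier_vec (dim_col A). vec_norm v \<le> 1}"
  then have dim: "dim_vec v = dim_col A" and le: "vec_norm v \<le> 1" by auto
  have comp: "cmod (v $ j) \<le> 1" if "j < dim_col A" for j
    using member_le_L2_set[of "{..<dim_vec v}" j "\<lambda>i. cmod (v $ i)"] le that dim
    by (simp add: vec_norm_def)
  have "vec_norm (A *\<^sub>v v) \<le> (\<Sum>i<dim_row A. cmod ((A *\<^sub>v v) $ i))"
    unfolding vec_norm_def dim_mult_mat_vec by (rule L2_set_le_sum) simp
  also have "\<dots> \<le> (\<Sum>i<dim_row A. \<Sum>j<dim_col A. cmod (A $$ (i,j)))"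
  proof (rule sum_mono)
    fix i assume i: "i \<in> {..<dim_row A}"
    have "(A *\<^sub>v v) $ i = (\<Sum>j<dim_col A. A $$ (i,j) * v $ j)"
      using i dim by (simp add: scalar_prod_def atLeast0LessThan)
    also have "cmod \<dots> \<le> (\<Sum>j<dim_col A. cmod (A $$ (i,j) * v $ j))"
      by (rule norm_sum)
    also have "\<dots> \<le> (\<Sum>j<dim_col A. cmod (A $$ (i,j)))"
      using comp by (intro sum_mono) (simp add: norm_mult mult_left_le)
    finally show "cmod ((A *\<^sub>v v) $ i) \<le> (\<Sum>j<dim_col A. cmod (A $$ (i,j)))" .
  qed
  finally show "vec_norm (A *\<^sub>v v) \<le> (\<Sum>i<dim_row A. \<Sum>j<dim_col A. cmod (A $$ (i,j)))" .
qed

end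

theory Submission
  imports Defs "Jordan_Normal_Form.Spectral_Radius"
begin

text \<open>A point outside an \<open>\<epsilon>\<close>-neighbourhood of \<open>[c, d]\<close> lies beyond the interval by a fixed amount in one of
the directions \<open>1\<close>, \<open>- 1\<close>, \<open>\<i>\<close>, \<open>- \<i>\<close>. So it suffices to bound, for one direction \<open>u\<close>, the number
\<open>k\<close> of eigenvalues of \<open>A = B + C\<close> with \<open>Re (u z) > t + \<delta>\<close>, when \<open>B\<close> has boundedly many eigenvalues
with \<open>Re (u z) > t\<close>.

The matrix \<open>A\<close> need not be normal, but it is triangular in some orthonormal basis
(\<open>unitary_schur\<close>), and there its eigenvalues are the numbers \<open>\<langle>A q\<^sub>j, q\<^sub>j\<rangle>\<close>. These are
additive in \<open>A\<close>, unlike eigenvalues themselves. Summing over the \<open>k\<close> indices in question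
gives at least \<open>k (t + \<delta>)\<close> in direction \<open>u\<close>, and the same sum splits into a partial trace of \<open>C\<close>
and one of \<open>B\<close> in an orthonormal system. The partial trace of \<open>C\<close> is bounded by the
trace norm (\<open>sum_diag_le_trace_norm\<close>). The one of \<open>B\<close> is at most \<open>k t\<close> plus a constant for
each eigenvalue of \<open>B\<close> beyond \<open>t\<close>, because \<open>B\<close> is diagonal in an orthonormal basis
(\<open>hermitian_sum_diag_le\<close>); that constant is bounded since the norms of \<open>A\<close> and \<open>C\<close> are. Comparing
both sides, \<open>k \<delta>\<close> is bounded (\<open>halfplane_count\<close>).\<close>

section \<open>Adjoints and unitary matrices\<close>

lemma carrier_mat_adjoint [simp]:
  "A \<in> carrier_mat m n \<Longrightarrow> mat_adjoint A \<in> carrier_mat n m"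
  by (auto simp: mat_adjoint_def)

lemma dim_mat_adjoint [simp]:
  "dim_row (mat_adjoint A) = dim_col A" "dim_col (mat_adjoint A) = dim_row A"
  by (auto simp: mat_adjoint_def)

lemma index_mat_adjoint [simp]:
  "i < dim_col A \<Longrightarrow> j < dim_row A \<Longrightarrow> mat_adjoint A $$ (i, j) = cnj (A $$ (j, i))"
  by (simp add: mat_adjoint_def mat_of_rows_index)

lemma index_mult_mat_sum:
  assumes "A \<in> carrier_mat l n" "B \<in> carrier_mat n m" "i < l" "j < m"
  shows "(A * B) $$ (i, j) = (\<Sum>k<n. A $$ (i, k) * B $$ (k, j))"
  using assms by (simp add: scalar_prod_def atLeast0LessThan)

lemma mat_adjoint_mult:
  assumes A: "A \<in> carrier_mat l n" and B: "B \<in> carrier_mat n m"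
  shows "mat_adjoint (A * B) = mat_adjoint B * mat_adjoint (A :: complex mat)"
proof (rule eq_matI)
  fix i j
  assume "i < dim_row (mat_adjoint B * mat_adjoint A)" "j < dim_col (mat_adjoint B * mat_adjoint A)"
  then have i: "i < m" and j: "j < l" using A B by auto
  have "mat_adjoint (A * B) $$ (i, j) = cnj (\<Sum>k<n. A $$ (j, k) * B $$ (k, i))"
    using i j A B index_mult_mat_sum[OF A B j i] by simp
  also have "\<dots> = (\<Sum>k<n. mat_adjoint B $$ (i, k) * mat_adjoint A $$ (k, j))"
    using i j A B by (simp add: mult.commute)
  also have "\<dots> = (mat_adjoint B * mat_adjoint A) $$ (i, j)"
    using index_mult_mat_sum[OF carrier_mat_adjoint[OF B] carrier_mat_adjoint[OF A] i j] by simp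
  finally show "mat_adjoint (A * B) $$ (i, j) = (mat_adjoint B * mat_adjoint A) $$ (i, j)" .
qed (use assms in auto)

lemma mat_adjoint_adjoint [simp]: "mat_adjoint (mat_adjoint A) = (A :: complex mat)"
  by (intro eq_matI) auto

definition unitary_mat :: "nat \<Rightarrow> complex mat \<Rightarrow> bool" where
  "unitary_mat n Q \<longleftrightarrow> Q \<in> carrier_mat n n \<and> mat_adjoint Q * Q = 1\<^sub>m n"

lemma unitary_matD:
  assumes "unitary_mat n Q"
  shows "Q \<in> carrier_mat n n" "mat_adjoint Q * Q = 1\<^sub>m n" "Q * mat_adjoint Q = 1\<^sub>m n"
  using assms mat_mult_left_right_inverse[of "mat_adjoint Q" n Q]
  by (auto simp: unitary_mat_def)

lemma unitary_mat_cancel: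
  assumes "unitary_mat n Q" and X: "X \<in> carrier_mat n m"
  shows "mat_adjoint Q * (Q * X) = X" "Q * (mat_adjoint Q * X) = X"
proof -
  note Q = unitary_matD[OF assms(1)]
  show "mat_adjoint Q * (Q * X) = X"
    unfolding assoc_mult_mat[OF carrier_mat_adjoint[OF Q(1)] Q(1) X, symmetric] Q(2)
    by (rule left_mult_one_mat[OF X])
  show "Q * (mat_adjoint Q * X) = X"
    unfolding assoc_mult_mat[OF Q(1) carrier_mat_adjoint[OF Q(1)] X, symmetric] Q(3)
    by (rule left_mult_one_mat[OF X])
qed

lemma unitary_mat_adjoint:
  assumes "unitary_mat n Q"
  shows "unitary_mat n (mat_adjoint Q)"
  using unitary_matD[OF assms] by (simp add: unitary_mat_def)

lemma unitary_mat_mult: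
  assumes P: "unitary_mat n P" and Q: "unitary_mat n Q"
  shows "unitary_mat n (P * Q)"
proof -
  note Pc = unitary_matD(1)[OF P] and Qc = unitary_matD(1)[OF Q]
  have "mat_adjoint (P * Q) * (P * Q) = mat_adjoint Q * (mat_adjoint P * (P * Q))"
    unfolding mat_adjoint_mult[OF Pc Qc]
    by (rule assoc_mult_mat[OF carrier_mat_adjoint[OF Qc] carrier_mat_adjoint[OF Pc]
          mult_carrier_mat[OF Pc Qc]])
  also have "\<dots> = 1\<^sub>m n"
    unfolding unitary_mat_cancel(1)[OF P Qc] by (rule unitary_matD(2)[OF Q])
  finally show ?thesis using Pc Qc by (simp add: unitary_mat_def)
qed

text \<open>The diagonal of a Gram matrix consists of squared column norms. This single fact yields that the
rows and columns of a unitary matrix have norm 1, and it identifies singular values with column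
norms in \<open>sum_diag_le_trace_norm\<close>.\<close>

lemma gram_diagonal:
  fixes M :: "complex mat"
  assumes "M \<in> carrier_mat m n" "i < n"
  shows "(mat_adjoint M * M) $$ (i, i) = complex_of_real (\<Sum>k<m. (cmod (M $$ (k, i)))\<^sup>2)"
proof -
  have "(mat_adjoint M * M) $$ (i, i) = (\<Sum>k<m. cnj (M $$ (k, i)) * M $$ (k, i))"
    using assms by (subst index_mult_mat_sum[of _ n m _ n]) auto
  also have "\<dots> = (\<Sum>k<m. complex_of_real ((cmod (M $$ (k, i)))\<^sup>2))"
    by (intro sum.cong refl) (simp only: complex_norm_square mult.commute)
  finally show ?thesis by simp
qed

lemma unitary_mat_col_norm:
  assumes "unitary_mat n Q" "j < n"
  shows "(\<Sum>i<n. (cmod (Q $$ (i, j)))\<^sup>2) = 1"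
proof -
  have "complex_of_real (\<Sum>i<n. (cmod (Q $$ (i, j)))\<^sup>2) = 1"
    unfolding gram_diagonal[OF unitary_matD(1)[OF assms(1)] assms(2), symmetric]
      unitary_matD(2)[OF assms(1)]
    using assms(2) by simp
  then show ?thesis by (simp only: of_real_eq_1_iff)
qed

lemma unitary_mat_row_norm:
  assumes "unitary_mat n Q" "i < n"
  shows "(\<Sum>j<n. (cmod (Q $$ (i, j)))\<^sup>2) = 1"
  using unitary_mat_col_norm[OF unitary_mat_adjoint[OF assms(1)] assms(2)] assms(2)
    unitary_matD(1)[OF assms(1)]
  by simp

section \<open>Unitary triangularization\<close>

text \<open>The vector is completed to a basis and orthogonalized, which keeps its direction; dividing the
resulting columns by their norms makes the matrix unitary.\<close>

lemma exists_unitary_first_col: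
  fixes v :: "complex vec"
  assumes v: "v \<in> carrier_vec n" and v0: "v \<noteq> 0\<^sub>v n"
  obtains W a where "unitary_mat n W" "col W 0 = a \<cdot>\<^sub>v v"
proof -
  interpret cof_vec_space n "TYPE(complex)" .
  define b where "b = basis_completion v"
  define ws where "ws = gram_schmidt n b"
  have b: "span (set b) = carrier_vec n" "distinct b" "\<not> lin_dep (set b)"
    "set b \<subseteq> carrier_vec n" "hd b = v" "length b = n"
    using basis_completion[OF v v0] unfolding b_def by auto
  have n: "n \<noteq> 0" using v v0 by auto
  obtain vs where bv: "b = v # vs" using b n by (cases b) auto
  have ws: "set ws \<subseteq> carrier_vec n" "corthogonal ws" "length ws = n"
    using gram_schmidt_result[OF b(4,2,3) ws_def] b(6) by auto
  have hd: "ws ! 0 = v"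
    using gram_schmidt_hd[OF v, of vs] ws(3) n unfolding ws_def bv by (metis hd_conv_nth length_0_conv)
  have car: "ws ! j \<in> carrier_vec n" if "j < n" for j using ws that by auto
  define r where "r j = (\<Sum>i<n. (cmod (ws ! j $ i))\<^sup>2)" for j
  have inner: "ws ! j \<bullet>c ws ! k = (\<Sum>i<n. ws ! j $ i * cnj (ws ! k $ i))" if "j < n" "k < n" for j k
    using car[OF that(1)] car[OF that(2)] by (simp add: scalar_prod_def atLeast0LessThan)
  have self: "ws ! j \<bullet>c ws ! j = complex_of_real (r j)" if "j < n" for j
    unfolding inner[OF that that] r_def of_real_sum
    by (intro sum.cong refl) (simp only: complex_norm_square)
  have r: "r j > 0" if "j < n" for j
  proof -
    have "r j \<noteq> 0" using self[OF that] corthogonalD[OF ws(2), of j j] ws(3) that by auto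
    moreover have "r j \<ge> 0" unfolding r_def by (simp add: sum_nonneg)
    ultimately show ?thesis by simp
  qed
  define W where "W = mat n n (\<lambda>(i, j). ws ! j $ i / complex_of_real (sqrt (r j)))"
  have W: "W \<in> carrier_mat n n" by (simp add: W_def)
  have "mat_adjoint W * W = 1\<^sub>m n"
  proof (rule eq_matI)
    fix j k assume "j < dim_row (1\<^sub>m n)" "k < dim_col (1\<^sub>m n)"
    then have jk: "j < n" "k < n" by auto
    have "(mat_adjoint W * W) $$ (j, k) = (\<Sum>i<n. cnj (W $$ (i, j)) * W $$ (i, k))"
      using W jk by (subst index_mult_mat_sum[of _ n n _ n]) auto
    also have "\<dots> = (ws ! k \<bullet>c ws ! j) / (complex_of_real (sqrt (r j)) * complex_of_real (sqrt (r k)))"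
      unfolding inner[OF jk(2,1)] sum_divide_distrib
      using jk by (intro sum.cong refl) (simp add: W_def mult.commute)
    also have "\<dots> = 1\<^sub>m n $$ (j, k)"
    proof (cases "j = k")
      case True
      have "complex_of_real (sqrt (r k)) * complex_of_real (sqrt (r k)) = complex_of_real (r k)"
        using r[OF jk(2)] by (metis of_real_mult real_sqrt_mult_self abs_of_pos)
      then show ?thesis using True self[OF jk(2)] r[OF jk(2)] jk by simp
    next
      case False
      then show ?thesis using corthogonalD[OF ws(2), of k j] ws(3) jk by simp
    qed
    finally show "(mat_adjoint W * W) $$ (j, k) = 1\<^sub>m n $$ (j, k)" .
  qed (use W carrier_mat_adjoint[OF W] in auto)
  moreover have "col W 0 = (1 / complex_of_real (sqrt (r 0))) \<cdot>\<^sub>v v"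
    using hd n v by (intro eq_vecI) (auto simp: W_def)
  ultimately show ?thesis using that W unfolding unitary_mat_def by blast
qed

text \<open>Schur's theorem with a unitary change of basis. Orthonormality matters because it makes the
diagonal entries of the triangular form values \<open>\<langle>A q, q\<rangle>\<close> at unit vectors, which the operator norm
and the trace norm control. In the induction, a unitary
matrix whose first column is an eigenvector splits off one row and one column, and the
remaining block is triangularized by the induction hypothesis.\<close>

lemma unitary_schur:
  assumes "A \<in> carrier_mat n n"
  shows "\<exists>Q. unitary_mat n Q \<and> upper_triangular (mat_adjoint Q * A * Q)"
  using assms
proof (induction n arbitrary: A)
  case 0
  then have "unitary_mat 0 (1\<^sub>m 0)"
    by (auto simp: unitary_mat_def intro!: eq_matI)
  moreover have "upper_triangular (mat_adjoint (1\<^sub>m 0) * A * 1\<^sub>m 0)"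
    by auto
  ultimately show ?case by blast
next
  case (Suc n)
  note A = Suc.prems
  obtain e where "eigenvalue A e" using spectrum_non_empty[OF A] by (auto simp: spectrum_def)
  then obtain v where v: "v \<in> carrier_vec (Suc n)" "v \<noteq> 0\<^sub>v (Suc n)" "A *\<^sub>v v = e \<cdot>\<^sub>v v"
    using A by (auto simp: eigenvalue_def eigenvector_def)
  obtain W a where W: "unitary_mat (Suc n) W" "col W 0 = a \<cdot>\<^sub>v v"
    using exists_unitary_first_col[OF v(1,2)] .
  note Wc = unitary_matD[OF W(1)]
  note Wa = carrier_mat_adjoint[OF Wc(1)]
  define A' where "A' = mat_adjoint W * (A * W)"
  have A': "A' \<in> carrier_mat (Suc n) (Suc n)" using A Wc Wa by (auto simp: A'_def)
  have colAW: "col (A * W) 0 = e \<cdot>\<^sub>v col W 0"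
  proof -
    have "col (A * W) 0 = A *\<^sub>v (a \<cdot>\<^sub>v v)"
      using A Wc(1) by (simp only: col_mult2[of A "Suc n" "Suc n" W "Suc n"] W(2) zero_less_Suc)
    also have "\<dots> = a \<cdot>\<^sub>v (e \<cdot>\<^sub>v v)"
      by (simp only: mult_mat_vec[OF A v(1)] v(3))
    finally show ?thesis by (simp add: W(2) smult_smult_assoc mult.commute)
  qed
  have first: "A' $$ (Suc i, 0) = 0" if "i < n" for i
  proof -
    have "A' $$ (Suc i, 0) = row (mat_adjoint W) (Suc i) \<bullet> (e \<cdot>\<^sub>v col W 0)"
      using A Wc Wa that colAW by (simp add: A'_def)
    also have "\<dots> = e * (mat_adjoint W * W) $$ (Suc i, 0)"
      using Wc(1) Wa that by simp
    also have "\<dots> = 0" unfolding Wc(2) using that by simp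
    finally show ?thesis .
  qed
  define A1 where "A1 = mat 1 1 (\<lambda>_. A' $$ (0, 0))"
  define A2 where "A2 = mat 1 n (\<lambda>(i, j). A' $$ (0, Suc j))"
  define A3 where "A3 = mat n n (\<lambda>(i, j). A' $$ (Suc i, Suc j))"
  have c: "A1 \<in> carrier_mat 1 1" "A2 \<in> carrier_mat 1 n" "A3 \<in> carrier_mat n n"
    by (auto simp: A1_def A2_def A3_def)
  have block: "A' = four_block_mat A1 A2 (0\<^sub>m n 1) A3"
    using A' first by (intro eq_matI) (auto simp: A1_def A2_def A3_def less_Suc_eq_0_disj)
  obtain P where P: "unitary_mat n P" "upper_triangular (mat_adjoint P * A3 * P)"
    using Suc.IH[OF c(3)] by blast
  note Pc = unitary_matD[OF P(1)]
  note Pa = carrier_mat_adjoint[OF Pc(1)]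
  define R where "R = four_block_mat (1\<^sub>m 1) (0\<^sub>m 1 n) (0\<^sub>m n 1) P"
  have R: "R \<in> carrier_mat (Suc n) (Suc n)" using Pc by (auto simp: R_def)
  have Ra: "mat_adjoint R = four_block_mat (1\<^sub>m 1) (0\<^sub>m 1 n) (0\<^sub>m n 1) (mat_adjoint P)"
    using Pc(1) Pa R carrier_mat_adjoint[OF R]
    by (intro eq_matI) (auto simp: R_def less_Suc_eq_0_disj)
  have "mat_adjoint R * R = four_block_mat (1\<^sub>m 1) (0\<^sub>m 1 n) (0\<^sub>m n 1) (1\<^sub>m n)"
    unfolding Ra unfolding R_def
    by (subst mult_four_block_mat[where ?nr1.0=1 and ?n1.0=1 and ?n2.0=n and ?nr2.0=n and ?nc1.0=1 and ?nc2.0=n])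
      (use Pc Pa in auto)
  also have "\<dots> = 1\<^sub>m (Suc n)" by (intro eq_matI) auto
  finally have uR: "unitary_mat (Suc n) R" using R by (simp add: unitary_mat_def)
  have step: "A' * R = four_block_mat A1 (A2 * P) (0\<^sub>m n 1) (A3 * P)"
    unfolding block R_def
    by (subst mult_four_block_mat[where ?nr1.0=1 and ?n1.0=1 and ?n2.0=n and ?nr2.0=n and ?nc1.0=1 and ?nc2.0=n])
      (use Pc Pa c in auto)
  have blockR: "mat_adjoint R * (A' * R)
      = four_block_mat A1 (A2 * P) (0\<^sub>m n 1) (mat_adjoint P * (A3 * P))"
    unfolding step Ra
    by (subst mult_four_block_mat[where ?nr1.0=1 and ?n1.0=1 and ?n2.0=n and ?nr2.0=n and ?nc1.0=1 and ?nc2.0=n])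
      (use Pc Pa c in auto)
  have "upper_triangular (mat_adjoint R * (A' * R))"
    unfolding blockR
    by (rule upper_triangular_four_block[of _ 1 _ n]) (use P(2) Pc Pa c in \<open>auto simp: A1_def\<close>)
  moreover have "mat_adjoint R * (A' * R) = mat_adjoint (W * R) * A * (W * R)"
  proof -
    note Ra' = carrier_mat_adjoint[OF R] and WR = mult_carrier_mat[OF Wc(1) R]
    have "A' * R = mat_adjoint W * (A * (W * R))"
      unfolding A'_def assoc_mult_mat[OF Wa mult_carrier_mat[OF A Wc(1)] R]
        assoc_mult_mat[OF A Wc(1) R] ..
    then have "mat_adjoint R * (A' * R) = mat_adjoint (W * R) * (A * (W * R))"
      unfolding mat_adjoint_mult[OF Wc(1) R]
      by (simp only: assoc_mult_mat[OF Ra' Wa mult_carrier_mat[OF A WR]])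
    then show ?thesis
      by (simp only: assoc_mult_mat[OF carrier_mat_adjoint[OF WR] A WR])
  qed
  ultimately show ?case using unitary_mat_mult[OF W(1) uR] by auto
qed

text \<open>The diagonal of the triangular form lists the eigenvalues with multiplicity. Indexing them by
\<open>{..<n}\<close> turns counting eigenvalues into counting diagonal positions.\<close>

lemma obtain_unitary_schur:
  assumes A: "A \<in> carrier_mat n n"
  obtains Q where "unitary_mat n Q" "upper_triangular (mat_adjoint Q * A * Q)"
    "eigenvalues A = image_mset (\<lambda>i. (mat_adjoint Q * A * Q) $$ (i, i)) (mset_set {..<n})"
proof -
  obtain Q where Q: "unitary_mat n Q" and ut: "upper_triangular (mat_adjoint Q * A * Q)"
    using unitary_schur[OF A] by blast
  note Qc = unitary_matD[OF Q]
  define T where "T = mat_adjoint Q * A * Q"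
  have T: "T \<in> carrier_mat n n" unfolding T_def by (rule mult_carrier_mat[OF mult_carrier_mat[OF carrier_mat_adjoint[OF Qc(1)] A] Qc(1)])
  have "similar_mat_wit T A (mat_adjoint Q) Q"
    by (rule similar_mat_witI[OF Qc(2,3) T_def T A carrier_mat_adjoint[OF Qc(1)] Qc(1)])
  then have "char_poly A = char_poly T"
    by (metis char_poly_similar similar_mat_def)
  also have "\<dots> = (\<Prod>a\<leftarrow>diag_mat T. [:- a, 1:])"
    using char_poly_upper_triangular[OF T] ut by (simp add: T_def)
  finally have cp: "char_poly A = (\<Prod>a\<leftarrow>diag_mat T. [:- a, 1:])" .
  have "proots (\<Prod>a\<leftarrow>xs. [:- a, 1:]) = mset xs" for xs :: "complex list"
  proof (induction xs)
    case (Cons a xs)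
    have "(\<Prod>a\<leftarrow>xs. [:- a, 1:]) \<noteq> 0" by (auto simp: prod_list_zero_iff)
    then have "proots ([:- a, 1:] * (\<Prod>a\<leftarrow>xs. [:- a, 1:])) = {#a#} + mset xs"
      using proots_mult[of "[:- a, 1:]"] Cons.IH by (simp del: mult_pCons_left)
    then show ?case by (simp del: mult_pCons_left)
  qed simp
  then have "eigenvalues A = mset (diag_mat T)" by (simp only: eigenvalues_def cp)
  also have "\<dots> = mset (map (\<lambda>i. T $$ (i, i)) [0..<n])"
    using T by (simp add: diag_mat_def)
  also have "\<dots> = image_mset (\<lambda>i. T $$ (i, i)) (mset_set {..<n})"
    by (simp only: mset_map mset_upt atLeast0LessThan)
  finally show ?thesis using that[OF Q ut] by (simp add: T_def)
qed

lemma size_filter_image_mset_set: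
  assumes "finite I"
  shows "size {#z \<in># image_mset f (mset_set I). P z#} = card {i \<in> I. P (f i)}"
  using assms by (simp add: filter_mset_image_mset)

text \<open>Together with \<open>hermitian_congruence\<close>, this makes the Schur form of a Hermitian matrix diagonal,
which is the spectral theorem.\<close>

lemma hermitian_upper_triangular_diagonal:
  assumes T: "T \<in> carrier_mat n n" and "hermitian T" "upper_triangular T"
    and ij: "i < n" "j < n" "i \<noteq> j"
  shows "T $$ (i, j) = 0"
proof -
  have "T $$ (i, j) = cnj (T $$ (j, i))"
    using assms index_mat_adjoint[of i T j] by (auto simp: hermitian_def)
  moreover have "T $$ (i, j) = 0 \<or> T $$ (j, i) = 0"
    using assms upper_triangularD[of T i j] upper_triangularD[of T j i] by (cases "i < j") auto
  ultimately show ?thesis by auto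
qed

lemma hermitian_congruence:
  assumes B: "B \<in> carrier_mat n n" and h: "hermitian B" and Q: "Q \<in> carrier_mat n n"
  shows "hermitian (mat_adjoint Q * B * Q)"
proof -
  note Qa = carrier_mat_adjoint[OF Q]
  have "mat_adjoint (mat_adjoint Q * B * Q) = mat_adjoint Q * (mat_adjoint B * Q)"
    using mat_adjoint_mult[OF mult_carrier_mat[OF Qa B] Q] mat_adjoint_mult[OF Qa B] by simp
  also have "\<dots> = mat_adjoint Q * B * Q"
    using h assoc_mult_mat[OF Qa B Q] by (simp add: hermitian_def)
  finally show ?thesis by (simp add: hermitian_def)
qed

section \<open>Partial traces in an orthonormal basis\<close>

text \<open>Let \<open>q\<^sub>j\<close> be the columns of \<open>Q\<close> and \<open>v\<^sub>i\<close> an orthonormal basis that triangularizes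
\<open>C\<^sup>* C\<close>. Expanding \<open>q\<^sub>j\<close> in the basis \<open>v\<^sub>i\<close> writes the partial trace as the double sum over
\<open>i\<close> and \<open>j\<close> of \<open>\<langle>C v\<^sub>i, q\<^sub>j\<rangle> \<langle>q\<^sub>j, v\<^sub>i\<rangle>\<close>. By the inequalities of Cauchy--Schwarz and Bessel,
the part belonging to \<open>i\<close> is at most \<open>\<parallel>C v\<^sub>i\<parallel> \<parallel>v\<^sub>i\<parallel> = \<parallel>C v\<^sub>i\<parallel>\<close>, and \<open>\<parallel>C v\<^sub>i\<parallel>\<^sup>2\<close> is the \<open>i\<close>-th diagonal entry of the Schur form
of \<open>C\<^sup>* C\<close>, that is, a squared singular value. The bound does not depend on the number of
terms in \<open>J\<close>.\<close>

lemma sum_diag_le_trace_norm: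
  assumes C: "C \<in> carrier_mat n n" and Q: "unitary_mat n Q" and J: "J \<subseteq> {..<n}"
  shows "cmod (\<Sum>j\<in>J. (mat_adjoint Q * C * Q) $$ (j, j)) \<le> trace_norm C"
proof -
  note Qc = unitary_matD(1)[OF Q] note Qa = carrier_mat_adjoint[OF Qc]
  note Ca = carrier_mat_adjoint[OF C]
  have CC: "mat_adjoint C * C \<in> carrier_mat n n" by (rule mult_carrier_mat[OF Ca C])
  obtain V where V: "unitary_mat n V" and
    ev: "eigenvalues (mat_adjoint C * C)
      = image_mset (\<lambda>i. (mat_adjoint V * (mat_adjoint C * C) * V) $$ (i, i)) (mset_set {..<n})"
    using obtain_unitary_schur[OF CC] by blast
  note Vc = unitary_matD(1)[OF V] note Va = carrier_mat_adjoint[OF Vc]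
  \<comment> \<open>\<open>M\<close> has the entries \<open>\<langle>C v\<^sub>i, q\<^sub>j\<rangle>\<close> and \<open>N\<close> the entries \<open>\<langle>q\<^sub>j, v\<^sub>i\<rangle>\<close>.\<close>
  define X where "X = C * V"
  define M where "M = mat_adjoint Q * X"
  define N where "N = mat_adjoint V * Q"
  have X: "X \<in> carrier_mat n n" using C Vc by (simp add: X_def)
  have M: "M \<in> carrier_mat n n" using X Qa by (simp add: M_def)
  have N: "unitary_mat n N"
    unfolding N_def by (rule unitary_mat_mult[OF unitary_mat_adjoint[OF V] Q])
  note Nc = unitary_matD(1)[OF N]
  have MN: "mat_adjoint Q * C * Q = M * N"
  proof -
    have "M * N = mat_adjoint Q * (C * (V * N))"
      unfolding M_def X_def assoc_mult_mat[OF C Vc Nc, symmetric]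
      by (rule assoc_mult_mat[OF Qa mult_carrier_mat[OF C Vc] Nc])
    also have "V * N = Q" unfolding N_def by (rule unitary_mat_cancel(2)[OF V Qc])
    finally show ?thesis using assoc_mult_mat[OF Qa C Qc] by simp
  qed
  have MM: "mat_adjoint M * M = mat_adjoint V * (mat_adjoint C * C) * V"
  proof -
    have "mat_adjoint M * M = mat_adjoint X * (Q * M)"
      unfolding M_def mat_adjoint_mult[OF Qa X] mat_adjoint_adjoint
      by (rule assoc_mult_mat[OF carrier_mat_adjoint[OF X] Qc mult_carrier_mat[OF Qa X]])
    also have "Q * M = X" unfolding M_def by (rule unitary_mat_cancel(2)[OF Q X])
    also have "mat_adjoint X * X = mat_adjoint V * (mat_adjoint C * (C * V))"
      unfolding X_def mat_adjoint_mult[OF C Vc]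
      by (rule assoc_mult_mat[OF Va Ca mult_carrier_mat[OF C Vc]])
    also have "\<dots> = mat_adjoint V * (mat_adjoint C * C) * V"
      unfolding assoc_mult_mat[OF Va CC Vc] assoc_mult_mat[OF Ca C Vc] ..
    finally show ?thesis .
  qed
  have tn: "trace_norm C = (\<Sum>i<n. L2_set (\<lambda>k. cmod (M $$ (k, i))) {..<n})"
  proof -
    have "trace_norm C = (\<Sum>i<n. sqrt (Re ((mat_adjoint M * M) $$ (i, i))))"
      by (simp add: trace_norm_def singular_values_def ev MM image_mset.compositionality o_def
          sum_unfold_sum_mset)
    also have "\<dots> = (\<Sum>i<n. L2_set (\<lambda>k. cmod (M $$ (k, i))) {..<n})"
      by (intro sum.cong refl) (simp only: gram_diagonal[OF M] lessThan_iff Re_complex_of_real L2_set_def)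
    finally show ?thesis .
  qed
  have fin: "finite J" using J finite_subset by blast
  have col_bound: "(\<Sum>j\<in>J. cmod (M $$ (j, i)) * cmod (N $$ (i, j))) \<le> L2_set (\<lambda>k. cmod (M $$ (k, i))) {..<n}"
    if i: "i < n" for i
  proof -
    have "(\<Sum>j\<in>J. cmod (M $$ (j, i)) * cmod (N $$ (i, j)))
      \<le> L2_set (\<lambda>k. cmod (M $$ (k, i))) J * L2_set (\<lambda>k. cmod (N $$ (i, k))) J"
      using L2_set_mult_ineq[of "\<lambda>k. cmod (M $$ (k, i))" "\<lambda>k. cmod (N $$ (i, k))" J] by simp
    also have "\<dots> \<le> L2_set (\<lambda>k. cmod (M $$ (k, i))) {..<n} * 1"
    proof (intro mult_mono)
      show "L2_set (\<lambda>k. cmod (M $$ (k, i))) J \<le> L2_set (\<lambda>k. cmod (M $$ (k, i))) {..<n}"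
        unfolding L2_set_def using J by (intro real_sqrt_le_mono sum_mono2) auto
      have "L2_set (\<lambda>k. cmod (N $$ (i, k))) J \<le> L2_set (\<lambda>k. cmod (N $$ (i, k))) {..<n}"
        unfolding L2_set_def using J by (intro real_sqrt_le_mono sum_mono2) auto
      then show "L2_set (\<lambda>k. cmod (N $$ (i, k))) J \<le> 1"
        using unitary_mat_row_norm[OF N i] by (simp add: L2_set_def)
    qed (auto simp: L2_set_nonneg)
    finally show ?thesis by simp
  qed
  have "cmod (\<Sum>j\<in>J. (M * N) $$ (j, j)) = cmod (\<Sum>j\<in>J. \<Sum>i<n. M $$ (j, i) * N $$ (i, j))"
  proof -
    have "(M * N) $$ (j, j) = (\<Sum>i<n. M $$ (j, i) * N $$ (i, j))" if "j \<in> J" for j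
      using index_mult_mat_sum[OF M Nc, of j j] that J by blast
    then show ?thesis by simp
  qed
  also have "\<dots> \<le> (\<Sum>j\<in>J. \<Sum>i<n. cmod (M $$ (j, i)) * cmod (N $$ (i, j)))"
    by (intro order_trans[OF norm_sum] sum_mono) (simp add: norm_mult)
  also have "\<dots> = (\<Sum>i<n. \<Sum>j\<in>J. cmod (M $$ (j, i)) * cmod (N $$ (i, j)))"
    by (rule sum.swap)
  also have "\<dots> \<le> trace_norm C"
    unfolding tn by (intro sum_mono) (use col_bound in auto)
  finally show ?thesis unfolding MN .
qed

lemma diag_le_op_norm:
  assumes A: "A \<in> carrier_mat n n" and Q: "unitary_mat n Q" and i: "i < n"
  shows "cmod ((mat_adjoint Q * A * Q) $$ (i, i)) \<le> op_norm A"
proof -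
  note Qc = unitary_matD(1)[OF Q] note Qa = carrier_mat_adjoint[OF Qc]
  define v where "v = col Q i"
  have v: "v \<in> carrier_vec n" using Qc i by (simp add: v_def)
  have nv: "L2_set (\<lambda>k. cmod (v $ k)) {..<n} = 1"
    using unitary_mat_col_norm[OF Q i] Qc i by (simp add: v_def L2_set_def)
  have Av: "dim_vec (A *\<^sub>v v) = n" using A by simp
  have "(mat_adjoint Q * A * Q) $$ (i, i) = (mat_adjoint Q * (A * Q)) $$ (i, i)"
    unfolding assoc_mult_mat[OF Qa A Qc] ..
  also have "\<dots> = (\<Sum>k<n. cnj (v $ k) * (A *\<^sub>v v) $ k)"
    using A Qc i
    by (simp only: index_mult_mat_sum[OF Qa mult_carrier_mat[OF A Qc] i i], intro sum.cong refl)
      (simp add: v_def)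
  finally have "cmod ((mat_adjoint Q * A * Q) $$ (i, i)) \<le> (\<Sum>k<n. cmod (v $ k) * cmod ((A *\<^sub>v v) $ k))"
    using norm_sum[of "\<lambda>k. cnj (v $ k) * (A *\<^sub>v v) $ k" "{..<n}"] by (simp add: norm_mult)
  also have "\<dots> \<le> L2_set (\<lambda>k. cmod (v $ k)) {..<n} * L2_set (\<lambda>k. cmod ((A *\<^sub>v v) $ k)) {..<n}"
    using L2_set_mult_ineq[of "\<lambda>k. cmod (v $ k)" "\<lambda>k. cmod ((A *\<^sub>v v) $ k)" "{..<n}"] by simp
  also have "\<dots> = vec_norm (A *\<^sub>v v)" unfolding nv vec_norm_def Av by simp
  also have "\<dots> \<le> op_norm A"
    unfolding op_norm_def using v nv A
    by (intro cSUP_upper bdd_above_op_norm) (auto simp: vec_norm_def)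
  finally show ?thesis .
qed

text \<open>Written in an orthonormal eigenbasis \<open>v\<^sub>i\<close> of \<open>B\<close> with eigenvalues \<open>d\<^sub>i\<close>, the partial trace is a
weighted sum of the \<open>d\<^sub>i\<close>, where the weight \<open>w\<^sub>i\<close> is the sum of \<open>\<bar>\<langle>q\<^sub>j, v\<^sub>i\<rangle>\<bar>\<^sup>2\<close> over \<open>j \<in> J\<close>. Bessel's
inequality gives \<open>w\<^sub>i \<le> 1\<close>, and the weights add up to \<open>card J\<close>. Hence replacing every
\<open>Re (u d\<^sub>i)\<close> by \<open>t\<close> costs at most \<open>R - t\<close> for each of the eigenvalues beyond the threshold \<open>t\<close>.
The factor \<open>u\<close> chooses a direction in the plane.\<close>

lemma hermitian_sum_diag_le:
  fixes t R :: real
  assumes B: "B \<in> carrier_mat n n" and h: "hermitian B"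
    and Q: "unitary_mat n Q" and J: "J \<subseteq> {..<n}"
    and R: "\<And>z. z \<in># eigenvalues B \<Longrightarrow> Re (u * z) \<le> R"
  shows "Re (u * (\<Sum>j\<in>J. (mat_adjoint Q * B * Q) $$ (j, j)))
    \<le> t * card J + size {#z \<in># eigenvalues B. Re (u * z) > t#} * (R - t)"
proof -
  note Qc = unitary_matD(1)[OF Q] note Qa = carrier_mat_adjoint[OF Qc]
  obtain V where V: "unitary_mat n V" and ut: "upper_triangular (mat_adjoint V * B * V)"
    and ev: "eigenvalues B = image_mset (\<lambda>i. (mat_adjoint V * B * V) $$ (i, i)) (mset_set {..<n})"
    using obtain_unitary_schur[OF B] by blast
  note Vc = unitary_matD(1)[OF V] note Va = carrier_mat_adjoint[OF Vc]
  define D where "D = mat_adjoint V * B * V"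
  define N where "N = mat_adjoint V * Q"
  have D: "D \<in> carrier_mat n n" unfolding D_def by (rule mult_carrier_mat[OF mult_carrier_mat[OF Va B] Vc])
  have N: "unitary_mat n N"
    unfolding N_def by (rule unitary_mat_mult[OF unitary_mat_adjoint[OF V] Q])
  note Nc = unitary_matD(1)[OF N] note Na = carrier_mat_adjoint[OF Nc]
  have off: "D $$ (i, j) = 0" if "i < n" "j < n" "i \<noteq> j" for i j
    using hermitian_upper_triangular_diagonal[OF D] hermitian_congruence[OF B h Vc] ut that
    by (simp add: D_def)
  have QBQ: "mat_adjoint Q * B * Q = mat_adjoint N * (D * N)"
  proof -
    have VN: "V * N = Q" unfolding N_def by (rule unitary_mat_cancel(2)[OF V Qc])
    have "mat_adjoint N * (D * N) = mat_adjoint N * (mat_adjoint V * (B * (V * N)))"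
      unfolding D_def assoc_mult_mat[OF mult_carrier_mat[OF Va B] Vc Nc]
        assoc_mult_mat[OF Va B mult_carrier_mat[OF Vc Nc]] ..
    also have "\<dots> = mat_adjoint (V * N) * (B * (V * N))"
      unfolding mat_adjoint_mult[OF Vc Nc]
      by (rule assoc_mult_mat[OF Na Va mult_carrier_mat[OF B mult_carrier_mat[OF Vc Nc]], symmetric])
    finally show ?thesis unfolding VN assoc_mult_mat[OF Qa B Qc] by simp
  qed
  define w where "w i = (\<Sum>j\<in>J. (cmod (N $$ (i, j)))\<^sup>2)" for i
  have entry: "(mat_adjoint Q * B * Q) $$ (j, j) = (\<Sum>i<n. D $$ (i, i) * complex_of_real ((cmod (N $$ (i, j)))\<^sup>2))"
    if j: "j < n" for j
  proof -
    have DN: "(D * N) $$ (i, j) = D $$ (i, i) * N $$ (i, j)" if i: "i < n" for i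
    proof -
      have "(D * N) $$ (i, j) = (\<Sum>k<n. D $$ (i, k) * N $$ (k, j))"
        by (rule index_mult_mat_sum[OF D Nc i j])
      also have "\<dots> = (\<Sum>k\<in>{i}. D $$ (i, k) * N $$ (k, j))"
        using i off by (intro sum.mono_neutral_right) auto
      finally show ?thesis by simp
    qed
    have "(mat_adjoint Q * B * Q) $$ (j, j) = (\<Sum>i<n. mat_adjoint N $$ (j, i) * (D * N) $$ (i, j))"
      unfolding QBQ by (rule index_mult_mat_sum[OF Na mult_carrier_mat[OF D Nc] j j])
    also have "\<dots> = (\<Sum>i<n. D $$ (i, i) * (N $$ (i, j) * cnj (N $$ (i, j))))"
      using Nc j DN by (intro sum.cong refl) (simp add: mult_ac)
    finally show ?thesis by (simp only: complex_norm_square)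
  qed
  have "(\<Sum>j\<in>J. (mat_adjoint Q * B * Q) $$ (j, j))
      = (\<Sum>j\<in>J. \<Sum>i<n. D $$ (i, i) * complex_of_real ((cmod (N $$ (i, j)))\<^sup>2))"
    using entry J by (intro sum.cong refl) blast
  also have "\<dots> = (\<Sum>i<n. D $$ (i, i) * complex_of_real (w i))"
    unfolding w_def of_real_sum sum_distrib_left by (rule sum.swap)
  finally have "Re (u * (\<Sum>j\<in>J. (mat_adjoint Q * B * Q) $$ (j, j))) = (\<Sum>i<n. Re (u * D $$ (i, i)) * w i)"
    by (simp add: sum_distrib_left flip: mult.assoc)
  also have "\<dots> \<le> (\<Sum>i<n. t * w i + (if Re (u * D $$ (i, i)) > t then R - t else 0))"
  proof (rule sum_mono)
    fix i assume "i \<in> {..<n}"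
    then have i: "i < n" by simp
    have w0: "0 \<le> w i" unfolding w_def by (simp add: sum_nonneg)
    have "w i \<le> (\<Sum>j<n. (cmod (N $$ (i, j)))\<^sup>2)"
      unfolding w_def using J by (intro sum_mono2) auto
    then have w1: "w i \<le> 1" using unitary_mat_row_norm[OF N i] by simp
    have "Re (u * D $$ (i, i)) \<le> R" using R i by (simp add: ev D_def)
    moreover have "(Re (u * D $$ (i, i)) - t) * w i \<le> (Re (u * D $$ (i, i)) - t) * 1"
      if "Re (u * D $$ (i, i)) > t" using that w1 by (intro mult_left_mono) auto
    moreover have "Re (u * D $$ (i, i)) * w i \<le> t * w i" if "\<not> Re (u * D $$ (i, i)) > t"
      using that w0 by (intro mult_right_mono) auto
    ultimately show "Re (u * D $$ (i, i)) * w i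
        \<le> t * w i + (if Re (u * D $$ (i, i)) > t then R - t else 0)"
      by (auto simp: left_diff_distrib)
  qed
  also have "\<dots> = t * (\<Sum>i<n. w i) + card {i \<in> {..<n}. Re (u * D $$ (i, i)) > t} * (R - t)"
    by (simp add: sum.distrib sum_distrib_left sum.If_cases Int_def)
  also have "(\<Sum>i<n. w i) = (\<Sum>j\<in>J. \<Sum>i<n. (cmod (N $$ (i, j)))\<^sup>2)"
    unfolding w_def by (rule sum.swap)
  also have "\<dots> = (\<Sum>j\<in>J. 1)"
    using unitary_mat_col_norm[OF N] J by (intro sum.cong refl) blast
  also have "card {i \<in> {..<n}. Re (u * D $$ (i, i)) > t} = size {#z \<in># eigenvalues B. Re (u * z) > t#}"
    unfolding ev D_def by (rule size_filter_image_mset_set[symmetric]) simp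
  finally show ?thesis by simp
qed

section \<open>Eigenvalues in a half-plane\<close>

text \<open>The heart of the argument. Let \<open>k\<close> be the number of eigenvalues of \<open>B + C\<close> with
\<open>Re (u z) > t + \<delta>\<close>. In a unitary Schur basis of \<open>B + C\<close> they are diagonal entries, so their sum,
which is at least \<open>k (t + \<delta>)\<close> in direction \<open>u\<close>, is the sum of a partial trace of \<open>B\<close> and one of \<open>C\<close>.
The former is at most \<open>k t\<close> plus a correction for the outliers of \<open>B\<close>, the latter at most \<open>L\<close>.
Subtracting \<open>k t\<close> leaves a bound for \<open>k \<delta>\<close>.

The bound on the norm of \<open>B + C\<close> serves to keep the outliers of \<open>B\<close> in a fixed disc:
every eigenvalue of \<open>B\<close> is a diagonal entry of \<open>B\<close> in some orthonormal basis, hence the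
difference of diagonal entries of \<open>B + C\<close> and \<open>C\<close>.\<close>

lemma halfplane_count:
  fixes t \<delta> :: real
  assumes B: "B \<in> carrier_mat n n" and C: "C \<in> carrier_mat n n" and h: "hermitian B"
    and u: "cmod u = 1" and K: "op_norm (B + C) \<le> K" and L: "trace_norm C \<le> L"
  shows "\<delta> * size {#z \<in># eigenvalues (B + C). Re (u * z) > t + \<delta>#}
    \<le> L + size {#z \<in># eigenvalues B. Re (u * z) > t#} * (K + L - t)"
proof -
  have A: "B + C \<in> carrier_mat n n" using B C by simp
  have split: "(mat_adjoint P * (B + C) * P) $$ (i, i)
      = (mat_adjoint P * B * P) $$ (i, i) + (mat_adjoint P * C * P) $$ (i, i)"
    if P: "unitary_mat n P" and i: "i < n" for P i
  proof -
    note Pc = unitary_matD(1)[OF P] note Pa = carrier_mat_adjoint[OF Pc]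
    show ?thesis
      unfolding mult_add_distrib_mat[OF Pa B C]
        add_mult_distrib_mat[OF mult_carrier_mat[OF Pa B] mult_carrier_mat[OF Pa C] Pc]
      using Pc i by simp
  qed
  have bound: "Re (u * z) \<le> K + L" if z_ev: "z \<in># eigenvalues B" for z
  proof -
    obtain V where V: "unitary_mat n V"
      and ev: "eigenvalues B = image_mset (\<lambda>i. (mat_adjoint V * B * V) $$ (i, i)) (mset_set {..<n})"
      using obtain_unitary_schur[OF B] by blast
    obtain i where i: "i < n" and z: "z = (mat_adjoint V * B * V) $$ (i, i)"
      using z_ev unfolding ev by auto
    have "z = (mat_adjoint V * (B + C) * V) $$ (i, i) - (mat_adjoint V * C * V) $$ (i, i)"
      using split[OF V i] z by simp
    then have "cmod z \<le> cmod ((mat_adjoint V * (B + C) * V) $$ (i, i)) + cmod ((mat_adjoint V * C * V) $$ (i, i))"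
      by (simp only: norm_triangle_ineq4)
    also have "\<dots> \<le> K + L"
      using diag_le_op_norm[OF A V i] sum_diag_le_trace_norm[OF C V, of "{i}"] i K L by simp
    finally show ?thesis using complex_Re_le_cmod[of "u * z"] u by (simp add: norm_mult)
  qed
  obtain Q where Q: "unitary_mat n Q" and ev: "eigenvalues (B + C)
      = image_mset (\<lambda>i. (mat_adjoint Q * (B + C) * Q) $$ (i, i)) (mset_set {..<n})"
    using obtain_unitary_schur[OF A] by blast
  define J where "J = {j \<in> {..<n}. Re (u * (mat_adjoint Q * (B + C) * Q) $$ (j, j)) > t + \<delta>}"
  have J: "J \<subseteq> {..<n}" by (auto simp: J_def)
  have card: "size {#z \<in># eigenvalues (B + C). Re (u * z) > t + \<delta>#} = card J"
    unfolding ev J_def by (rule size_filter_image_mset_set) simp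
  have "(t + \<delta>) * card J = (\<Sum>j\<in>J. t + \<delta>)" by simp
  also have "\<dots> \<le> (\<Sum>j\<in>J. Re (u * (mat_adjoint Q * (B + C) * Q) $$ (j, j)))"
    by (rule sum_mono) (auto simp: J_def)
  also have "\<dots> = Re (u * (\<Sum>j\<in>J. (mat_adjoint Q * (B + C) * Q) $$ (j, j)))"
    by (simp only: sum_distrib_left Re_sum)
  also have "(\<Sum>j\<in>J. (mat_adjoint Q * (B + C) * Q) $$ (j, j))
      = (\<Sum>j\<in>J. (mat_adjoint Q * B * Q) $$ (j, j)) + (\<Sum>j\<in>J. (mat_adjoint Q * C * Q) $$ (j, j))"
    unfolding sum.distrib[symmetric] using J by (intro sum.cong refl split[OF Q]) auto
  also have "Re (u * \<dots>) = Re (u * (\<Sum>j\<in>J. (mat_adjoint Q * B * Q) $$ (j, j)))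
      + Re (u * (\<Sum>j\<in>J. (mat_adjoint Q * C * Q) $$ (j, j)))"
    by (simp only: distrib_left plus_complex.sel)
  also have "Re (u * (\<Sum>j\<in>J. (mat_adjoint Q * C * Q) $$ (j, j))) \<le> L"
    using complex_Re_le_cmod[of "u * (\<Sum>j\<in>J. (mat_adjoint Q * C * Q) $$ (j, j))"]
      sum_diag_le_trace_norm[OF C Q J] u L by (simp only: norm_mult)
  also have "Re (u * (\<Sum>j\<in>J. (mat_adjoint Q * B * Q) $$ (j, j)))
      \<le> t * card J + size {#z \<in># eigenvalues B. Re (u * z) > t#} * (K + L - t)"
    by (rule hermitian_sum_diag_le[OF B h Q J bound])
  finally show ?thesis unfolding card by (simp add: algebra_simps)
qed

lemma size_filter_mset_mono:
  "(\<And>z. P z \<Longrightarrow> Q z) \<Longrightarrow> size {#z \<in># M. P z#} \<le> size {#z \<in># M. Q z#}"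
  by (induction M) auto

text \<open>Since \<open>S\<close> lies in \<open>Re (u z) \<le> h\<close>, a point beyond this half-plane by more than \<open>\<delta>\<close> is outside the
\<open>\<delta>\<close>-neighbourhood of \<open>S\<close>, so the eigenvalues of \<open>B\<close> there are boundedly many. The second
\<open>\<delta>\<close> is the gap that \<open>halfplane_count\<close> needs.\<close>

lemma halfplane_outliers_bounded:
  fixes A B C :: "nat \<Rightarrow> complex mat"
  assumes "matrix_sequence B" "matrix_sequence C" "\<forall>\<^sub>F n in sequentially. hermitian (B n)"
    and A: "\<And>n. A n = B n + C n"
    and cl: "strongly_clustered B S"
    and tr: "(\<lambda>n. trace_norm (C n)) \<in> O(\<lambda>_. 1)"
    and K: "\<And>n. op_norm (A n) \<le> K"
    and u: "cmod u = 1" and h: "\<And>s. s \<in> S \<Longrightarrow> Re (u * s) \<le> h" and \<delta>: "\<delta> > 0"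
  shows "(\<lambda>n. real (size {#z \<in># eigenvalues (A n). Re (u * z) > h + 2 * \<delta>#})) \<in> O(\<lambda>_. 1)"
proof -
  obtain L where L: "\<forall>\<^sub>F n in sequentially. norm (trace_norm (C n)) \<le> L * norm (1 :: real)"
    using tr by (elim landau_o.bigE)
  have "(\<lambda>n. real (size {#z \<in># eigenvalues (B n). z \<notin> nbhd S \<delta>#})) \<in> O(\<lambda>_. 1)"
    using cl \<delta> by (simp add: strongly_clustered_def)
  then obtain M where
    M: "\<forall>\<^sub>F n in sequentially. norm (real (size {#z \<in># eigenvalues (B n). z \<notin> nbhd S \<delta>#})) \<le> M * norm (1 :: real)"
    by (elim landau_o.bigE)
  have out: "z \<notin> nbhd S \<delta>" if "Re (u * z) > h + \<delta>" for z
  proof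
    assume "z \<in> nbhd S \<delta>"
    then obtain s where s: "s \<in> S" "cmod (z - s) < \<delta>" by (auto simp: nbhd_def)
    have "Re (u * (z - s)) \<le> cmod (z - s)"
      using complex_Re_le_cmod[of "u * (z - s)"] u by (simp only: norm_mult)
    then have "Re (u * z) - Re (u * s) < \<delta>" using s(2) by (simp add: right_diff_distrib)
    then show False using that h[OF s(1)] by simp
  qed
  show ?thesis
  proof (rule bigoI)
    show "\<forall>\<^sub>F n in sequentially. norm (real (size {#z \<in># eigenvalues (A n). Re (u * z) > h + 2 * \<delta>#}))
        \<le> ((L + M * \<bar>K + L - (h + \<delta>)\<bar>) / \<delta>) * norm (1 :: real)"
      using assms(3) L M
    proof eventually_elim
      case (elim n)
      let ?m = "size {#z \<in># eigenvalues (B n). Re (u * z) > h + \<delta>#}"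
      have "?m \<le> size {#z \<in># eigenvalues (B n). z \<notin> nbhd S \<delta>#}"
        using out by (intro size_filter_mset_mono)
      then have m: "real ?m \<le> M" using elim(3) by simp
      have "\<delta> * size {#z \<in># eigenvalues (A n). Re (u * z) > h + 2 * \<delta>#} \<le> L + ?m * (K + L - (h + \<delta>))"
        using halfplane_count[of "B n" n "C n" u K L \<delta> "h + \<delta>"] elim assms(1,2) u K[of n]
        by (simp add: A matrix_sequence_def add.assoc)
      also have "?m * (K + L - (h + \<delta>)) \<le> ?m * \<bar>K + L - (h + \<delta>)\<bar>"
        by (intro mult_left_mono) auto
      also have "\<dots> \<le> M * \<bar>K + L - (h + \<delta>)\<bar>"
        using m by (intro mult_right_mono) auto
      finally show ?case using \<delta> by (simp add: field_simps)
    qed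
  qed
qed

lemma size_filter_disj_le:
  "size {#z \<in># M. P z \<or> Q z#} \<le> size {#z \<in># M. P z#} + size {#z \<in># M. Q z#}"
  by (induction M) auto

section \<open>Clustering at an interval\<close>

text \<open>If all four inequalities fail, then \<open>z\<close> differs from its nearest point of the interval by at most
\<open>2 \<epsilon> / 5\<close> in the real and in the imaginary part, thus by less than \<open>\<epsilon>\<close>. The four half-planes keep
the redundant factors and summands so that they are literally those of
\<open>halfplane_outliers_bounded\<close> for \<open>u = 1, - 1, \<i>, - \<i>\<close>.\<close>

lemma outside_nbhd_interval:
  assumes "c \<le> d" "\<epsilon> > 0" and z: "z \<notin> nbhd (complex_of_real ` {c..d}) \<epsilon>"
  shows "(Re (1 * z) > d + 2 * (\<epsilon> / 5) \<or> Re (- 1 * z) > - c + 2 * (\<epsilon> / 5)) \<or>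
    (Re (\<i> * z) > 0 + 2 * (\<epsilon> / 5) \<or> Re (- \<i> * z) > 0 + 2 * (\<epsilon> / 5))"
proof (rule ccontr)
  assume *: "\<not> ?thesis"
  define s where "s = max c (min d (Re z))"
  have s: "s \<in> {c..d}" using assms by (auto simp: s_def)
  have "\<bar>Re z - s\<bar> \<le> 2 * (\<epsilon> / 5)" "\<bar>Im z\<bar> \<le> 2 * (\<epsilon> / 5)"
    using * assms(1,2) by (auto simp: s_def max_def min_def abs_if)
  then have "cmod (z - complex_of_real s) < \<epsilon>"
    using cmod_le[of "z - complex_of_real s"] assms(2) by simp
  then show False using z s by (auto simp: nbhd_def)
qed

theorem theorem3p5:
  fixes A B C :: "nat \<Rightarrow> complex mat" and c d K :: real
  assumes "matrix_sequence B"
    and "matrix_sequence C"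
    and "\<forall>\<^sub>F n in sequentially. hermitian (B n)"
    and "\<And>n. A n = B n + C n"
    and "c \<le> d"
    and "strongly_clustered B (complex_of_real ` {c..d})"
    and "(\<lambda>n. trace_norm (C n)) \<in> O(\<lambda>_. 1)"
    and "K > 0"
    and "\<And>n. op_norm (A n) \<le> K"
  shows "strongly_clustered A (complex_of_real ` {c..d})"
  unfolding strongly_clustered_def
proof (intro allI impI)
  fix \<epsilon> :: real assume \<epsilon>: "\<epsilon> > 0"
  let ?S = "complex_of_real ` {c..d}"
  define k where "k u h n = real (size {#z \<in># eigenvalues (A n). Re (u * z) > h + 2 * (\<epsilon> / 5)#})"
    for u h n
  have bnd: "k u h \<in> O(\<lambda>_. 1)" if "cmod u = 1" "\<And>s. s \<in> ?S \<Longrightarrow> Re (u * s) \<le> h" for u h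
    unfolding k_def using \<epsilon> that
    by (intro halfplane_outliers_bounded[OF assms(1,2,3,4,6,7,9)]) auto
  have "(\<lambda>n. (k 1 d n + k (- 1) (- c) n) + (k \<i> 0 n + k (- \<i>) 0 n)) \<in> O(\<lambda>_. 1)"
    by (intro sum_in_bigo bnd) auto
  moreover have "(\<lambda>n. real (size {#z \<in># eigenvalues (A n). z \<notin> nbhd ?S \<epsilon>#}))
      \<in> O(\<lambda>n. (k 1 d n + k (- 1) (- c) n) + (k \<i> 0 n + k (- \<i>) 0 n))"
  proof (intro landau_o.big_mono always_eventually allI)
    fix n
    let ?k = "\<lambda>P. size {#z \<in># eigenvalues (A n). P z#}"
    define P where "P u h z \<longleftrightarrow> Re (u * z) > h + 2 * (\<epsilon> / 5)" for u h z
    have "?k (\<lambda>z. z \<notin> nbhd ?S \<epsilon>) \<le> ?k (\<lambda>z. (P 1 d z \<or> P (- 1) (- c) z) \<or> (P \<i> 0 z \<or> P (- \<i>) 0 z))"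
      using outside_nbhd_interval[OF assms(5) \<epsilon>]
      by (intro size_filter_mset_mono) (simp add: P_def)
    also have "\<dots> \<le> (?k (P 1 d) + ?k (P (- 1) (- c))) + (?k (P \<i> 0) + ?k (P (- \<i>) 0))"
      by (intro order_trans[OF size_filter_disj_le] add_mono size_filter_disj_le)
    finally show "norm (real (?k (\<lambda>z. z \<notin> nbhd ?S \<epsilon>)))
        \<le> norm ((k 1 d n + k (- 1) (- c) n) + (k \<i> 0 n + k (- \<i>) 0 n))"
      by (simp add: k_def P_def)
  qed
  ultimately show "(\<lambda>n. real (size {#z \<in># eigenvalues (A n). z \<notin> nbhd ?S \<epsilon>#})) \<in> O(\<lambda>_. 1)"
    by (rule landau_o.big_trans[rotated])
qed

end
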